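(* Let $a,b,c\geq 1$ be integers and let $x$ be a complex number with $x^3\neq 1$. Write $\mathcal{BJ}_{n}^{(a,b,c)}$ for $\mathcal{BJ}_{n}^{(a,b,c)}(x)$, and for $n\geq 1$ put $\mathcal{T}_{n}^{(a,b,c)}=\mathcal{BJ}_{n}^{(a,b,c)}-(x-1)\mathcal{BJ}_{n-1}^{(a,b,c)}$. Let $n\geq 0$ be an integer. Then $$\begin{bmatrix} \mathcal{BJ}_{n+3}^{(a,b,c)}& \mathcal{T}_{n+4}^{(a,b,c)}& x\mathcal{BJ}_{n+2}^{(a,b,c)} \\ \mathcal{BJ}_{n+2}^{(a,b,c)}& \mathcal{T}_{n+3}^{(a,b,c)}& x\mathcal{BJ}_{n+1}^{(a,b,c)} \\ \mathcal{BJ}_{n+1}^{(a,b,c)}& \mathcal{T}_{n+2}^{(a,b,c)}& x\mathcal{BJ}_{n}^{(a,b,c)} \end{bmatrix}=\begin{bmatrix} \mathcal{BJ}_{3}^{(a,b,c)}& \mathcal{T}_{4}^{(a,b,c)}& x\mathcal{BJ}_{2}^{(a,b,c)} \\ \mathcal{BJ}_{2}^{(a,b,c)}& \mathcal{T}_{3}^{(a,b,c)}& x\mathcal{BJ}_{1}^{(a,b,c)} \\ \mathcal{BJ}_{1}^{(a,b,c)}& \mathcal{T}_{2}^{(a,b,c)}& x\mathcal{BJ}_{0}^{(a,b,c)} \end{bmatrix}\cdot \mathbf{Q}_{\mathcal{J}}^{\,n},\qquad\text{where}\quad \mathbf{Q}_{\mathcal{J}}=\begin{bmatrix}x-1& x-1&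 x \\ 1& 0 & 0 \\ 0 & 1& 0\end{bmatrix}.$$
   Context: The third-order Jacobsthal polynomials are defined, for $x^3\neq 1$, by $\mathcal{J}_{0}^{(3)}(x)=0$, $\mathcal{J}_{1}^{(3)}(x)=1$, $\mathcal{J}_{2}^{(3)}(x)=x-1$ and $\mathcal{J}_{n+3}^{(3)}(x)=(x-1)\mathcal{J}_{n+2}^{(3)}(x)+(x-1)\mathcal{J}_{n+1}^{(3)}(x)+x\mathcal{J}_{n}^{(3)}(x)$ for $n\geq 0$. Bihyperbolic numbers are the elements $a_0+a_1j_1+a_2j_2+a_3j_3$ with multiplication determined by $j_1^2=j_2^2=j_3^2=1$, $j_1j_2=j_2j_1=j_3$, $j_1j_3=j_3j_1=j_2$, $j_2j_3=j_3j_2=j_1$; this gives a commutative associative unital algebra with basis $1,j_1,j_2,j_3$ (over $\mathbb{R}$ for bihyperbolic numbers proper). All identities are read in its complexification, i.e. coefficients $a_i$ are allowed to be complex. For integers $a,b,c\geq1$ and $n\geq 0$, the generalized bihyperbolic third-order Jacobsthal polynomial is $\mathcal{BJ}_{n}^{(a,b,c)}(x)=\mathcal{J}_{n}^{(3)}(x)+\mathcal{J}_{n+a}^{(3)}(x)j_{1}+\mathcal{J}_{n+b}^{(3)}(x)j_{2}+\mathcal{J}_{n+c}^{(3)}(x)j_{3}$. *)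

theory Defs
  imports Complex_Main "Jordan_Normal_Form.Matrix"
begin

text \<open>\<open>Bihyp a\<^sub>0 a\<^sub>1 a\<^sub>2 a\<^sub>3\<close> stands for \<open>a\<^sub>0 + a\<^sub>1 j\<^sub>1 + a\<^sub>2 j\<^sub>2 + a\<^sub>3 j\<^sub>3\<close>. The bihyperbolic numbers proper
  have real coefficients; complex coefficients give their complexification.\<close>

datatype 'a bihyperbolic = Bihyp (bh0: 'a) (bh1: 'a) (bh2: 'a) (bh3: 'a)

instantiation bihyperbolic :: (comm_ring_1) comm_ring_1
begin

definition "0 = Bihyp 0 0 0 0"

definition "1 = Bihyp 1 0 0 0"

definition "u + v = Bihyp (bh0 u + bh0 v) (bh1 u + bh1 v) (bh2 u + bh2 v) (bh3 u + bh3 v)"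

definition "u - v = Bihyp (bh0 u - bh0 v) (bh1 u - bh1 v) (bh2 u - bh2 v) (bh3 u - bh3 v)"

definition "- u = Bihyp (- bh0 u) (- bh1 u) (- bh2 u) (- bh3 u)"

text \<open>The bilinear extension of the multiplication table that is proved as
  \<open>bihyperbolic_mult_table\<close> below.\<close>

definition "u * v = Bihyp
  (bh0 u * bh0 v + bh1 u * bh1 v + bh2 u * bh2 v + bh3 u * bh3 v)
  (bh0 u * bh1 v + bh1 u * bh0 v + bh2 u * bh3 v + bh3 u * bh2 v)
  (bh0 u * bh2 v + bh2 u * bh0 v + bh1 u * bh3 v + bh3 u * bh1 v)
  (bh0 u * bh3 v + bh3 u * bh0 v + bh1 u * bh2 v + bh2 u * bh1 v)"

instance
  by standard
    (simp_all add: zero_bihyperbolic_def one_bihyperbolic_def plus_bihyperbolic_def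
      minus_bihyperbolic_def uminus_bihyperbolic_def times_bihyperbolic_def
      bihyperbolic.expand algebra_simps)

end

definition j1 :: "'a::comm_ring_1 bihyperbolic" where "j1 = Bihyp 0 1 0 0"

definition j2 :: "'a::comm_ring_1 bihyperbolic" where "j2 = Bihyp 0 0 1 0"

definition j3 :: "'a::comm_ring_1 bihyperbolic" where "j3 = Bihyp 0 0 0 1"

text \<open>The embedding \<open>a \<mapsto> a\<cdot>1\<close> of the coefficient ring; scalar multiplication by \<open>a\<close> is
  multiplication by \<open>scal a\<close>.\<close>

definition scal :: "'a::comm_ring_1 \<Rightarrow> 'a bihyperbolic" where
  "scal a = Bihyp a 0 0 0"

lemma bihyperbolic_mult_table:
  "j1 * j1 = 1" "j2 * j2 = 1" "j3 * j3 = 1"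
  "j1 * j2 = j3" "j2 * j1 = j3" "j1 * j3 = j2" "j3 * j1 = j2" "j2 * j3 = j1" "j3 * j2 = j1"
  by (simp_all add: j1_def j2_def j3_def one_bihyperbolic_def times_bihyperbolic_def)

lemma bihyperbolic_expansion:
  "Bihyp a0 a1 a2 a3 = scal a0 + scal a1 * j1 + scal a2 * j2 + scal a3 * j3"
  by (simp add: scal_def j1_def j2_def j3_def plus_bihyperbolic_def times_bihyperbolic_def)

lemma scal_mult: "scal a * Bihyp a0 a1 a2 a3 = Bihyp (a * a0) (a * a1) (a * a2) (a * a3)"
  by (simp add: scal_def times_bihyperbolic_def)

lemma scal_hom:
  "scal 0 = 0" "scal 1 = 1" "scal (a + b) = scal a + scal b" "scal (a - b) = scal a - scal b"
  "scal (a * b) = scal a * scal b"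
  by (simp_all add: scal_def zero_bihyperbolic_def one_bihyperbolic_def plus_bihyperbolic_def
      minus_bihyperbolic_def times_bihyperbolic_def)

fun jacobsthal3 :: "nat \<Rightarrow> complex \<Rightarrow> complex" where
  "jacobsthal3 0 x = 0"
| "jacobsthal3 (Suc 0) x = 1"
| "jacobsthal3 (Suc (Suc 0)) x = x - 1"
| "jacobsthal3 (Suc (Suc (Suc n))) x =
     (x - 1) * jacobsthal3 (Suc (Suc n)) x + (x - 1) * jacobsthal3 (Suc n) x + x * jacobsthal3 n x"

definition BJ :: "nat \<Rightarrow> nat \<Rightarrow> nat \<Rightarrow> complex \<Rightarrow> nat \<Rightarrow> complex bihyperbolic" where
  "BJ a b c x n = scal (jacobsthal3 n x) + scal (jacobsthal3 (n + a) x) * j1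
     + scal (jacobsthal3 (n + b) x) * j2 + scal (jacobsthal3 (n + c) x) * j3"

text \<open>Meaningful for \<open>n \<ge> 1\<close> only, since subtraction on \<^typ>\<open>nat\<close> truncates.\<close>

definition BT :: "nat \<Rightarrow> nat \<Rightarrow> nat \<Rightarrow> complex \<Rightarrow> nat \<Rightarrow> complex bihyperbolic" where
  "BT a b c x n = BJ a b c x n - scal (x - 1) * BJ a b c x (n - 1)"

definition QJ :: "complex \<Rightarrow> complex mat" where
  "QJ x = mat_of_rows_list 3
     [[x - 1, x - 1, x],
      [1, 0, 0],
      [0, 1, 0]]"

end

theory Submission
  imports Defs
begin

text \<open>
  Right multiplication by \<open>Q\<close> advances every row of the matrix by one index. A row has the form
  \<open>(B\<^sub>m\<^sub>+\<^sub>1, T\<^sub>m\<^sub>+\<^sub>2, x B\<^sub>m)\<close>, and \<open>T\<^sub>m\<^sub>+\<^sub>2\<close> is the part of the three-term recurrence for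
  \<open>B\<^sub>m\<^sub>+\<^sub>2\<close> that remains after its leading summand \<open>(x - 1) B\<^sub>m\<^sub>+\<^sub>1\<close> has been removed. Hence
  \<open>(x - 1) B\<^sub>m\<^sub>+\<^sub>1 + T\<^sub>m\<^sub>+\<^sub>2 = B\<^sub>m\<^sub>+\<^sub>2\<close> by the definition of \<open>T\<close>, and
  \<open>(x - 1) B\<^sub>m\<^sub>+\<^sub>1 + x B\<^sub>m = T\<^sub>m\<^sub>+\<^sub>3\<close> by the recurrence (\<open>BT_step\<close>): these are the first two
  entries of the row times \<open>Q\<close>, and the third is \<open>x B\<^sub>m\<^sub>+\<^sub>1\<close>. The claim follows by induction on the
  exponent, since applying the ring homomorphism \<^const>\<open>scal\<close> entrywise respects matrix products.
\<close>

interpretation scal: semiring_hom scal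
  by standard (simp_all add: scal_hom)

text \<open>The Jacobsthal recurrence is linear with coefficients independent of the index, so it passes
  to the index-shifted components simultaneously.\<close>

lemma BJ_recurrence:
  "BJ a b c x (m + 3) =
     scal (x - 1) * BJ a b c x (m + 2) + scal (x - 1) * BJ a b c x (m + 1) + scal x * BJ a b c x m"
proof -
  have J: "jacobsthal3 (k + 3) x =
      (x - 1) * jacobsthal3 (k + 2) x + (x - 1) * jacobsthal3 (k + 1) x + x * jacobsthal3 k x" for k
    by (simp add: numeral_3_eq_3)
  have B: "BJ a b c x k = Bihyp (jacobsthal3 k x) (jacobsthal3 (k + a) x)
      (jacobsthal3 (k + b) x) (jacobsthal3 (k + c) x)" for k
    by (simp only: BJ_def bihyperbolic_expansion)
  show ?thesis
    unfolding B scal_mult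
    using J[of m] J[of "m + a"] J[of "m + b"] J[of "m + c"]
    by (simp add: plus_bihyperbolic_def ac_simps)
qed

lemma BT_step:
  "BT a b c x (m + 3) = scal (x - 1) * BJ a b c x (m + 1) + scal x * BJ a b c x m"
  by (simp add: BT_def BJ_recurrence)

definition BJ_matrix :: "nat \<Rightarrow> nat \<Rightarrow> nat \<Rightarrow> complex \<Rightarrow> nat \<Rightarrow> complex bihyperbolic mat" where
  "BJ_matrix a b c x n = mat_of_rows_list 3
     [[BJ a b c x (n + 3), BT a b c x (n + 4), scal x * BJ a b c x (n + 2)],
      [BJ a b c x (n + 2), BT a b c x (n + 3), scal x * BJ a b c x (n + 1)],
      [BJ a b c x (n + 1), BT a b c x (n + 2), scal x * BJ a b c x n]]"

lemma BJ_matrix_carrier: "BJ_matrix a b c x n \<in> carrier_mat 3 3"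
  by (simp add: BJ_matrix_def mat_of_rows_list_def numeral_3_eq_3)

lemma QJ_carrier: "QJ x \<in> carrier_mat 3 3"
  by (simp add: QJ_def mat_of_rows_list_def numeral_3_eq_3)

lemma mat3_times_QJ:
  "mat_of_rows_list 3 [[p1, q1, r1], [p2, q2, r2], [p3, q3, r3]] * map_mat scal (QJ x) =
   mat_of_rows_list 3
     [[scal (x - 1) * p1 + q1, scal (x - 1) * p1 + r1, scal x * p1],
      [scal (x - 1) * p2 + q2, scal (x - 1) * p2 + r2, scal x * p2],
      [scal (x - 1) * p3 + q3, scal (x - 1) * p3 + r3, scal x * p3]]"
  by (rule eq_matI)
    (auto simp: QJ_def mat_of_rows_list_def scalar_prod_def numeral_3_eq_3 less_Suc_eq
      scal_hom mult.commute)

lemma BJ_matrix_Suc: "BJ_matrix a b c x (Suc n) = BJ_matrix a b c x n * map_mat scal (QJ x)"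
proof -
  have first: "scal (x - 1) * BJ a b c x (m + 1) + BT a b c x (m + 2) = BJ a b c x (m + 2)" for m
    by (simp add: BT_def)
  show ?thesis
    unfolding BJ_matrix_def mat3_times_QJ
    using first[of n] first[of "n + 1"] first[of "n + 2"]
      BT_step[of a b c x n] BT_step[of a b c x "n + 1"] BT_step[of a b c x "n + 2"]
    by (simp add: eval_nat_numeral ac_simps)
qed

lemma BJ_matrix_power: "BJ_matrix a b c x n = BJ_matrix a b c x 0 * map_mat scal (QJ x ^\<^sub>m n)"
proof (induction n)
  case 0
  have "map_mat scal (1\<^sub>m 3) = (1\<^sub>m 3 :: complex bihyperbolic mat)"
    by (rule scal.mat_hom_one)
  then show ?case
    using BJ_matrix_carrier[of a b c x 0] QJ_carrier[of x] by simp
next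
  case (Suc n)
  have P: "QJ x ^\<^sub>m n \<in> carrier_mat 3 3"
    using QJ_carrier by (rule pow_carrier_mat)
  have "BJ_matrix a b c x (Suc n)
      = BJ_matrix a b c x 0 * map_mat scal (QJ x ^\<^sub>m n) * map_mat scal (QJ x)"
    by (simp add: BJ_matrix_Suc Suc)
  also have "\<dots> = BJ_matrix a b c x 0 * (map_mat scal (QJ x ^\<^sub>m n) * map_mat scal (QJ x))"
    by (rule assoc_mult_mat[OF BJ_matrix_carrier map_carrier_mat[THEN iffD2, OF P]
          map_carrier_mat[THEN iffD2, OF QJ_carrier]])
  also have "\<dots> = BJ_matrix a b c x 0 * map_mat scal (QJ x ^\<^sub>m Suc n)"
    by (simp add: scal.mat_hom_mult[OF P QJ_carrier])
  finally show ?case .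
qed

theorem theorem2p14:
  fixes a b c n :: nat and x :: complex
  assumes "a \<ge> 1" and "b \<ge> 1" and "c \<ge> 1" and "x ^ 3 \<noteq> 1"
  shows
    "mat_of_rows_list 3
       [[BJ a b c x (n + 3), BT a b c x (n + 4), scal x * BJ a b c x (n + 2)],
        [BJ a b c x (n + 2), BT a b c x (n + 3), scal x * BJ a b c x (n + 1)],
        [BJ a b c x (n + 1), BT a b c x (n + 2), scal x * BJ a b c x n]]
     = mat_of_rows_list 3
       [[BJ a b c x 3, BT a b c x 4, scal x * BJ a b c x 2],
        [BJ a b c x 2, BT a b c x 3, scal x * BJ a b c x 1],
        [BJ a b c x 1, BT a b c x 2, scal x * BJ a b c x 0]]
       * map_mat scal (QJ x ^\<^sub>m n)"
  using BJ_matrix_power[of a b c x n] unfolding BJ_matrix_def add_0 .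

end
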